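(* Let $n\ge 2$, $1\le h(1)\le n$, $h=(h(1),n,\ldots,n)$, and let $P_h$ be the poset on $[n]$ with $i<_{P_h}j$ iff $h(i)<j$. Let $B_1$ be the set of monomials $x_1^{i_1}\cdots x_n^{i_n}$ with $0\le i_j\le n-j$ for all $j$ that are not divisible by $\prod_{\ell=1}^{h(1)}x_\ell$. Define $\varphi$ on $B_1$ as follows: start with a column consisting of one box containing $n$; for $k=n-1,n-2,\ldots,1$ in turn, insert a new box containing $k$ into the column at the unique position such that exactly $i_k$ of the entries already in the column lie below it. Call the result $T_0$. If $i_1=0$, set $\varphi(x_1^{i_1}\cdots x_n^{i_n})=T_0$. Otherwise let $k'$ be the smallest index in $\{1,\ldots,h(1)\}$ with $i_{k'}=0$ (then $k'$ occupies the bottom box of $T_0$), and let $\varphi(x_1^{i_1}\cdots x_n^{i_n})$ be the column obtained from $T_0$ by removing $k'$ from the bottom and reinserting it directly below the entry $1$. Then $\varphi$ is a well-defined map from $B_1$ to the set of $P_h$-tableaux of shape $(1^n)$, and it is a bijection.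
   Context: A $P$-tableau of shape $\lambda$ (for a poset $P$ on $[n]$, French convention: rows are read bottom to top, the first/longest row at the bottom) is a filling of the Young diagram of $\lambda$ using each element of $[n]$ exactly once such that if $j$ is directly to the right of $i$ then $j>_P i$, and if $j$ is directly above $i$ then $j\not<_P i$. A tableau of shape $(1^n)$ is a single column of $n$ boxes. *)

theory Defs
  imports Main "HOL-Library.Poly_Mapping"
begin

text \<open>
  A monomial is its exponent vector of type \<^typ>\<open>nat \<Rightarrow>\<^sub>0 nat\<close>, the variable \<open>x\<^sub>l\<close> being
  \<open>single l 1\<close>. Multiplication of monomials is addition of exponent vectors.
\<close>

type_synonym monomial = "nat \<Rightarrow>\<^sub>0 nat"

definition monomial_dvd :: "monomial \<Rightarrow> monomial \<Rightarrow> bool" where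
  "monomial_dvd u m \<longleftrightarrow> (\<exists>q. m = u + q)"

definition B1 :: "nat \<Rightarrow> (nat \<Rightarrow> nat) \<Rightarrow> monomial set" where
  "B1 n h = {m. Poly_Mapping.keys m \<subseteq> {1..n}
              \<and> (\<forall>j\<in>{1..n}. Poly_Mapping.lookup m j \<le> n - j)
              \<and> \<not> monomial_dvd (\<Sum>l=1..h 1. Poly_Mapping.single l 1) m}"

definition hess_less :: "nat \<Rightarrow> (nat \<Rightarrow> nat) \<Rightarrow> nat \<Rightarrow> nat \<Rightarrow> bool" where
  "hess_less n h i j \<longleftrightarrow> i \<in> {1..n} \<and> j \<in> {1..n} \<and> h i < j"

definition is_partition_of :: "nat list \<Rightarrow> nat \<Rightarrow> bool" where
  "is_partition_of lam n \<longleftrightarrow> sorted_wrt (\<ge>) lam \<and> 0 \<notin> set lam \<and> sum_list lam = n"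

text \<open>
  A filling is the list of its rows, from the bottom row to the top row (French convention);
  each row is read from left to right. Below, \<open>lt\<close> is the strict order of a poset on \<open>{1..n}\<close>.
\<close>

definition P_tableaux :: "nat \<Rightarrow> (nat \<Rightarrow> nat \<Rightarrow> bool) \<Rightarrow> nat list \<Rightarrow> nat list list set" where
  "P_tableaux n lt lam = {T.
     is_partition_of lam n \<and> map length T = lam
     \<and> distinct (concat T) \<and> set (concat T) = {1..n}
     \<and> (\<forall>r c. r < length T \<and> Suc c < length (T ! r) \<longrightarrow> lt (T ! r ! c) (T ! r ! Suc c))
     \<and> (\<forall>r c. Suc r < length T \<and> c < length (T ! Suc r) \<longrightarrow>
            \<not> lt (T ! Suc r ! c) (T ! r ! c))}"

text \<open>
  In the construction of \<open>\<phi>\<close> a column is the list of its entries from bottom to top.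
  \<open>is_insertion k i xs ys\<close>: the column \<open>ys\<close> arises from \<open>xs\<close> by inserting a box \<open>k\<close> such that
  exactly \<open>i\<close> entries of \<open>xs\<close> lie below it.
\<close>

definition is_insertion :: "nat \<Rightarrow> nat \<Rightarrow> nat list \<Rightarrow> nat list \<Rightarrow> bool" where
  "is_insertion k i xs ys \<longleftrightarrow> (\<exists>us vs. xs = us @ vs \<and> ys = us @ k # vs \<and> length us = i)"

definition insert_box :: "nat \<Rightarrow> nat \<Rightarrow> nat list \<Rightarrow> nat list" where
  "insert_box k i xs = (THE ys. is_insertion k i xs ys)"

text \<open>The column after the boxes \<open>n, n - 1, \<dots>, k\<close> have been placed; \<open>T\<^sub>0\<close> is the case \<open>k = 1\<close>.\<close>

definition partial_column :: "nat \<Rightarrow> monomial \<Rightarrow> nat \<Rightarrow> nat list" where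
  "partial_column n m k =
     fold (\<lambda>j. insert_box j (Poly_Mapping.lookup m j)) (rev [k..<n]) [n]"

definition T0 :: "nat \<Rightarrow> monomial \<Rightarrow> nat list" where
  "T0 n m = partial_column n m 1"

definition k_prime :: "(nat \<Rightarrow> nat) \<Rightarrow> monomial \<Rightarrow> nat" where
  "k_prime h m = (LEAST k. k \<in> {1..h 1} \<and> Poly_Mapping.lookup m k = 0)"

definition insert_below :: "nat \<Rightarrow> nat \<Rightarrow> nat list \<Rightarrow> nat list" where
  "insert_below k e xs = takeWhile (\<lambda>x. x \<noteq> e) xs @ k # dropWhile (\<lambda>x. x \<noteq> e) xs"

definition phi_column :: "nat \<Rightarrow> (nat \<Rightarrow> nat) \<Rightarrow> monomial \<Rightarrow> nat list" where
  "phi_column n h m =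
     (if Poly_Mapping.lookup m 1 = 0 then T0 n m
      else insert_below (k_prime h m) 1 (tl (T0 n m)))"

definition phi :: "nat \<Rightarrow> (nat \<Rightarrow> nat) \<Rightarrow> monomial \<Rightarrow> nat list list" where
  "phi n h m = map (\<lambda>x. [x]) (phi_column n h m)"

end

theory Submission
  imports Defs
begin

text \<open>
  The map \<open>T\<^sub>0\<close> is the Lehmer code bijection from exponent vectors with \<open>i\<^sub>j \<le> n - j\<close> to
  orderings of \<open>{1..n}\<close>: the entries \<open>\<ge> k\<close> of \<open>T\<^sub>0\<close> form the column obtained after inserting \<open>k\<close>.
  The bottom entry of \<open>T\<^sub>0\<close> is the least \<open>k\<close> with \<open>i\<^sub>k = 0\<close>, so \<open>B\<^sub>1\<close> corresponds to the orderings
  whose bottom entry is at most \<open>h(1)\<close>. A column is a \<open>P\<^sub>h\<close>-tableau iff \<open>1\<close> is at the bottom or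
  the entry directly below \<open>1\<close> is at most \<open>h(1)\<close>; moving the bottom entry directly below \<open>1\<close>
  matches these two sets of orderings.
\<close>

section \<open>Stages of the insertion process\<close>

definition columns :: "nat \<Rightarrow> nat list set" where
  "columns n = {xs. distinct xs \<and> set xs = {1..n}}"

definition staircase :: "nat \<Rightarrow> monomial set" where
  "staircase n = {m. Poly_Mapping.keys m \<subseteq> {1..n} \<and> (\<forall>j\<in>{1..n}. Poly_Mapping.lookup m j \<le> n - j)}"

lemma staircase_lookup_last:
  assumes "m \<in> staircase n" "1 \<le> n"
  shows "Poly_Mapping.lookup m n = 0"
proof -
  have "n \<in> {1..n}" using assms(2) by simp
  then have "Poly_Mapping.lookup m n \<le> n - n"
    using assms(1) unfolding staircase_def by blast
  then show ?thesis by simp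
qed

text \<open>The bound gives \<open>take i xs\<close> length exactly \<open>i\<close>, which yields
  existence; uniqueness holds because the length of the lower part fixes the cut. So the
  \<open>THE\<close> in \<open>insert_box\<close> denotes.\<close>

lemma is_insertion_iff:
  assumes "i \<le> length xs"
  shows "is_insertion k i xs ys \<longleftrightarrow> ys = take i xs @ k # drop i xs"
proof
  assume "ys = take i xs @ k # drop i xs"
  then show "is_insertion k i xs ys"
    unfolding is_insertion_def using assms
    by (intro exI[of _ "take i xs"] exI[of _ "drop i xs"]) auto
qed (auto simp: is_insertion_def)

lemma insert_box_eq:
  assumes "i \<le> length xs"
  shows "insert_box k i xs = take i xs @ k # drop i xs"
  using assms by (simp add: insert_box_def is_insertion_iff)

lemma partial_column_step:
  assumes "k < n"
  shows "partial_column n m k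
    = insert_box k (Poly_Mapping.lookup m k) (partial_column n m (Suc k))"
  using assms by (simp add: partial_column_def upt_conv_Cons)

lemma partial_column_last [simp]: "partial_column n m n = [n]"
  by (simp add: partial_column_def)

text \<open>Downward induction on \<open>k\<close>. The length is carried along because it turns the
  bound \<open>n - k\<close> on the exponent into a legal insertion position.\<close>

lemma partial_column_entries:
  assumes "m \<in> staircase n" "1 \<le> k" "k \<le> n"
  shows "distinct (partial_column n m k) \<and> set (partial_column n m k) = {k..n}
    \<and> length (partial_column n m k) = Suc n - k"
  using assms(3,2)
proof (induction k rule: inc_induct)
  case (step k)
  let ?i = "Poly_Mapping.lookup m k" and ?xs = "partial_column n m (Suc k)"
  have IH: "distinct ?xs" "set ?xs = {Suc k..n}" "length ?xs = n - k"
    using step by auto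
  have "partial_column n m k = take ?i ?xs @ k # drop ?i ?xs"
    using assms(1) step IH by (simp add: partial_column_step insert_box_eq staircase_def)
  then obtain us vs where split: "?xs = us @ vs" "partial_column n m k = us @ k # vs"
    by (metis append_take_drop_id)
  have range: "insert k {Suc k..n} = {k..n}"
    using step.hyps by auto
  have set_eq: "set us \<union> set vs = {Suc k..n}"
    using IH(2) split(1) by simp
  then have "k \<notin> set us \<union> set vs"
    by simp
  then have "distinct (partial_column n m k)"
    using IH(1) unfolding split by simp
  moreover have "set (partial_column n m k) = {k..n}"
    using set_eq range unfolding split by simp
  moreover have "length (partial_column n m k) = Suc n - k"
    using IH(3) step.hyps unfolding split by simp
  ultimately show ?case by blast
qed auto

lemma partial_column_Suc:
  assumes "m \<in> staircase n" "1 \<le> k" "k < n"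
  defines "i \<equiv> Poly_Mapping.lookup m k" and "xs \<equiv> partial_column n m (Suc k)"
  shows "i \<le> length xs" and "partial_column n m k = take i xs @ k # drop i xs"
proof -
  show "i \<le> length xs"
    using partial_column_entries[OF assms(1), of "Suc k"] assms by (auto simp: staircase_def)
  then show "partial_column n m k = take i xs @ k # drop i xs"
    using assms(3) by (simp add: partial_column_step insert_box_eq i_def xs_def)
qed

text \<open>Insertion keeps the order of the older boxes, and all of them exceed \<open>k\<close>,
  so deleting \<open>k\<close> undoes it. Every stage can thus be recovered from
  \<open>T0\<close>.\<close>

lemma filter_partial_column:
  assumes "m \<in> staircase n" "1 \<le> k" "k < n"
  shows "filter (\<lambda>x. Suc k \<le> x) (partial_column n m k) = partial_column n m (Suc k)"
proof -
  let ?i = "Poly_Mapping.lookup m k" and ?xs = "partial_column n m (Suc k)"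
  have "\<forall>x\<in>set ?xs. Suc k \<le> x"
    using partial_column_entries[OF assms(1), of "Suc k"] assms by auto
  then have "filter (\<lambda>x. Suc k \<le> x) (take ?i ?xs) = take ?i ?xs"
    "filter (\<lambda>x. Suc k \<le> x) (drop ?i ?xs) = drop ?i ?xs"
    by (auto simp: filter_id_conv dest: in_set_takeD in_set_dropD)
  then show ?thesis
    using partial_column_Suc[OF assms] by simp
qed

lemma T0_in_columns:
  assumes "m \<in> staircase n" "1 \<le> n"
  shows "T0 n m \<in> columns n"
  using partial_column_entries[OF assms(1), of 1] assms(2) by (auto simp: columns_def T0_def)

section \<open>The Lehmer code bijection\<close>

lemma append_Cons_fresh_eq:
  assumes "us @ k # vs = us' @ k # vs'" "k \<notin> set us" "k \<notin> set us'"
  shows "us = us'"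
proof -
  have "takeWhile (\<lambda>x. x \<noteq> k) (us @ k # vs) = us" "takeWhile (\<lambda>x. x \<noteq> k) (us' @ k # vs') = us'"
    using assms(2,3) by (auto simp: takeWhile_append)
  with assms(1) show ?thesis by simp
qed

text \<open>Equal final columns have equal stages by repeated filtering, and the position of
  \<open>k\<close> in stage \<open>k\<close> is its exponent.\<close>

lemma inj_on_T0:
  assumes "1 \<le> n"
  shows "inj_on (T0 n) (staircase n)"
proof (rule inj_onI)
  fix m m' assume m: "m \<in> staircase n" and m': "m' \<in> staircase n" and eq: "T0 n m = T0 n m'"
  \<comment> \<open>The shift by \<open>Suc\<close> makes \<open>k = 0\<close> the final column
    itself, so the induction starts from \<open>eq\<close>.\<close>
  have pc: "partial_column n m (Suc k) = partial_column n m' (Suc k)" if "k < n" for k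
    using that
  proof (induction k)
    case (Suc k)
    then show ?case
      using filter_partial_column[OF m, of "Suc k"] filter_partial_column[OF m', of "Suc k"] by simp
  qed (use eq in \<open>simp add: T0_def\<close>)
  have "Poly_Mapping.lookup m k = Poly_Mapping.lookup m' k" for k
  proof (cases "1 \<le> k \<and> k < n")
    case True
    let ?xs = "partial_column n m (Suc k)"
    let ?i = "Poly_Mapping.lookup m k" and ?i' = "Poly_Mapping.lookup m' k"
    have xs: "?xs = partial_column n m' (Suc k)"
      using True pc by blast
    have "partial_column n m k = partial_column n m' k"
      using True pc[of "k - 1"] by (cases k) auto
    then have "take ?i ?xs @ k # drop ?i ?xs = take ?i' ?xs @ k # drop ?i' ?xs"
      using partial_column_Suc(2)[OF m, of k] partial_column_Suc(2)[OF m', of k] True xs by simp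
    moreover have "k \<notin> set ?xs"
      using partial_column_entries[OF m, of "Suc k"] True by auto
    ultimately have "take ?i ?xs = take ?i' ?xs"
      by (metis append_Cons_fresh_eq in_set_takeD)
    then have "length (take ?i ?xs) = length (take ?i' ?xs)"
      by (rule arg_cong)
    moreover have "?i \<le> length ?xs" "?i' \<le> length ?xs"
      using partial_column_Suc(1)[OF m, of k] partial_column_Suc(1)[OF m', of k] True
      unfolding xs by blast+
    ultimately show ?thesis
      by (simp only: length_take min.absorb2)
  next
    case False
    \<comment> \<open>No insertion records these exponents: they vanish by the support condition, or
      by the bound \<open>n - n\<close>.\<close>
    then have "k \<notin> {1..n} \<or> k = n"
      by auto
    then show ?thesis
    proof
      assume "k \<notin> {1..n}"
      then have "k \<notin> Poly_Mapping.keys m" "k \<notin> Poly_Mapping.keys m'"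
        using m m' by (auto simp: staircase_def)
      then show ?thesis by (simp add: in_keys_iff)
    qed (simp add: staircase_lookup_last[OF m assms] staircase_lookup_last[OF m' assms])
  qed
  then show "m = m'"
    by (rule poly_mapping_eqI)
qed

text \<open>The preimage is the code of \<open>xs\<close>: its exponent at \<open>k\<close> counts
  the entries larger than \<open>k\<close> that lie below \<open>k\<close>.\<close>

lemma T0_surj:
  assumes xs: "xs \<in> columns n" and "1 \<le> n"
  shows "\<exists>m\<in>staircase n. T0 n m = xs"
proof -
  \<comment> \<open>The default 0 keeps the support inside \<open>{1..n}\<close>; it is then finite,
    as \<open>Abs_poly_mapping\<close> requires.\<close>
  define f where "f k = (if k \<in> {1..n}
      then length (filter (\<lambda>x. Suc k \<le> x) (takeWhile (\<lambda>x. x \<noteq> k) xs)) else 0)" for k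
  define m where "m = Abs_poly_mapping f"
  have "finite {k. f k \<noteq> 0}"
    by (rule finite_subset[of _ "{1..n}"]) (auto simp: f_def)
  then have lookup: "Poly_Mapping.lookup m = f"
    by (simp add: m_def)
  have dist: "distinct xs" and set_xs: "set xs = {1..n}"
    using xs by (auto simp: columns_def)
  have f_le: "f k \<le> n - k" if "k \<in> {1..n}" for k
  proof -
    let ?ys = "filter (\<lambda>x. Suc k \<le> x) (takeWhile (\<lambda>x. x \<noteq> k) xs)"
    have "length ?ys = card (set ?ys)"
      using dist by (intro distinct_card[symmetric]) (simp add: distinct_takeWhile)
    also have "\<dots> \<le> card {Suc k..n}"
      using set_xs by (intro card_mono) (auto dest: set_takeWhileD)
    finally show ?thesis
      using that by (simp add: f_def)
  qed
  have m: "m \<in> staircase n"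
    using f_le by (auto simp: staircase_def in_keys_iff lookup f_def split: if_splits)
  \<comment> \<open>Stage \<open>k\<close> is \<open>xs\<close> restricted to the entries at least
    \<open>k\<close>; at \<open>k = 1\<close> this is all of \<open>xs\<close>.\<close>
  have "partial_column n m k = filter (\<lambda>x. k \<le> x) xs" if "k \<le> n" "1 \<le> k" for k
    using that
  proof (induction k rule: inc_induct)
    case base
    obtain us vs where xs_split: "xs = us @ n # vs"
      using split_list[of n xs] set_xs \<open>1 \<le> n\<close> by auto
    have "\<forall>x\<in>set us \<union> set vs. \<not> n \<le> x"
      using dist set_xs xs_split by (auto simp: set_eq_iff) (metis le_antisym)+
    then show ?case
      by (simp add: xs_split filter_empty_conv)
  next
    case (step k)
    then obtain us vs where xs_split: "xs = us @ k # vs"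
      using split_list[of k xs] set_xs by auto
    have fresh: "k \<notin> set us" "k \<notin> set vs"
      using dist xs_split by auto
    have "takeWhile (\<lambda>x. x \<noteq> k) xs = us"
      using fresh(1) by (auto simp: xs_split takeWhile_append)
    then have fk: "f k = length (filter (\<lambda>x. Suc k \<le> x) us)"
      using step by (simp add: f_def)
    have ge: "filter (\<lambda>x. k \<le> x) ws = filter (\<lambda>x. Suc k \<le> x) ws" if "k \<notin> set ws" for ws
      using that by (intro filter_cong) (auto simp: Suc_le_eq le_less)
    \<comment> \<open>By \<open>fk\<close>, inserting at height \<open>f k\<close> cuts the previous
      stage exactly between the surviving entries of \<open>us\<close> and those of
      \<open>vs\<close>.\<close>
    show ?case
      using partial_column_Suc(2)[OF m, of k] step
      by (simp add: lookup fk xs_split ge fresh)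
  qed
  from this[of 1] have "T0 n m = xs"
    using \<open>1 \<le> n\<close> set_xs by (auto simp: T0_def filter_id_conv)
  with m show ?thesis by blast
qed

lemma bij_betw_T0:
  assumes "1 \<le> n"
  shows "bij_betw (T0 n) (staircase n) (columns n)"
proof (rule bij_betw_imageI[OF inj_on_T0[OF assms]])
  show "T0 n ` staircase n = columns n"
    using T0_in_columns[OF _ assms] T0_surj[OF _ assms] by fast
qed

section \<open>The bottom entry of \<open>T0\<close> and the set \<open>B1\<close>\<close>

lemma hd_T0:
  assumes m: "m \<in> staircase n" and "1 \<le> k" "k \<le> n"
    and "Poly_Mapping.lookup m k = 0" "\<And>j. 1 \<le> j \<Longrightarrow> j < k \<Longrightarrow> Poly_Mapping.lookup m j \<noteq> 0"
  shows "hd (T0 n m) = k"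
proof -
  \<comment> \<open>Exponent 0 puts \<open>k\<close> at the bottom; each later \<open>j\<close> has
    a nonzero exponent, hence goes above at least one box and leaves the bottom unchanged.\<close>
  have "hd (partial_column n m j) = k" if "j \<le> k" "1 \<le> j" for j
    using that
  proof (induction j rule: inc_induct)
    case base
    show ?case
      using partial_column_Suc(2)[OF m, of k] assms by (cases "k = n") auto
  next
    case (step j)
    have "partial_column n m (Suc j) \<noteq> []"
      using partial_column_entries[OF m, of "Suc j"] step assms(3) by auto
    then show ?case
      using partial_column_Suc(2)[OF m, of j] step assms(3) assms(5)[of j] by (simp add: hd_append)
  qed
  then show ?thesis
    using assms(2) by (simp add: T0_def)
qed

text \<open>The exponent at \<open>n\<close> is 0, so a least index with exponent 0 exists, and
  \<open>hd_T0\<close> identifies it with the bottom entry.\<close>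

lemma lookup_hd_T0:
  assumes m: "m \<in> staircase n" and "1 \<le> n"
  defines "b \<equiv> hd (T0 n m)"
  shows "1 \<le> b" "b \<le> n" "Poly_Mapping.lookup m b = 0"
    "\<And>j. 1 \<le> j \<Longrightarrow> j < b \<Longrightarrow> Poly_Mapping.lookup m j \<noteq> 0"
proof -
  let ?P = "\<lambda>k. 1 \<le> k \<and> Poly_Mapping.lookup m k = 0"
  have n: "?P n"
    using staircase_lookup_last[OF m] \<open>1 \<le> n\<close> by simp
  define k where "k = (LEAST k. ?P k)"
  have k: "?P k" "k \<le> n"
    unfolding k_def using n by (rule LeastI, rule Least_le)
  have least: "Poly_Mapping.lookup m j \<noteq> 0" if "1 \<le> j" "j < k" for j
    using not_less_Least[of j ?P] that by (auto simp: k_def)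
  have "b = k"
    unfolding b_def using k least by (intro hd_T0[OF m]) auto
  then show "1 \<le> b" "b \<le> n" "Poly_Mapping.lookup m b = 0"
    "\<And>j. 1 \<le> j \<Longrightarrow> j < b \<Longrightarrow> Poly_Mapping.lookup m j \<noteq> 0"
    using k least by auto
qed

lemma monomial_dvd_iff:
  "monomial_dvd u m \<longleftrightarrow> (\<forall>j. Poly_Mapping.lookup u j \<le> Poly_Mapping.lookup m j)"
proof
  assume le: "\<forall>j. Poly_Mapping.lookup u j \<le> Poly_Mapping.lookup m j"
  \<comment> \<open>Truncated subtraction of exponents is exact here by \<open>le\<close>.\<close>
  have "m = u + (m - u)"
    using le by (intro poly_mapping_eqI) (simp add: lookup_add lookup_minus)
  then show "monomial_dvd u m"
    unfolding monomial_dvd_def by blast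
qed (auto simp: monomial_dvd_def lookup_add)

lemma lookup_sum_single:
  fixes p :: nat
  shows "Poly_Mapping.lookup (\<Sum>l=1..p. Poly_Mapping.single l (1::nat)) j
    = (if j \<in> {1..p} then 1 else 0)"
proof -
  have "Poly_Mapping.lookup (\<Sum>l=1..p. Poly_Mapping.single l (1::nat)) j
    = (\<Sum>l\<in>{1..p}. if l = j then 1 else 0)"
    by (simp add: lookup_sum lookup_single when_def del: One_nat_def)
  also have "\<dots> = (if j \<in> {1..p} then 1 else 0)"
    by (rule sum.delta) simp
  finally show ?thesis .
qed

text \<open>The forbidden divisor is squarefree, so it divides \<open>m\<close> iff none of the
  first \<open>h 1\<close> exponents vanishes.\<close>

lemma B1_eq:
  "B1 n h = {m \<in> staircase n. \<exists>k\<in>{1..h 1}. Poly_Mapping.lookup m k = 0}"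
proof -
  have "monomial_dvd (\<Sum>l=1..h 1. Poly_Mapping.single l 1) m
    \<longleftrightarrow> (\<forall>k\<in>{1..h 1}. Poly_Mapping.lookup m k \<noteq> 0)" for m
    unfolding monomial_dvd_iff lookup_sum_single by (auto simp: Suc_le_eq)
  then show ?thesis
    by (simp add: B1_def staircase_def conj_assoc del: One_nat_def)
qed

text \<open>Some index up to \<open>h 1\<close> has exponent 0 iff the least index with exponent 0,
  the bottom entry, is at most \<open>h 1\<close>.\<close>

lemma B1_eq_hd_T0:
  assumes "1 \<le> n"
  shows "B1 n h = {m \<in> staircase n. hd (T0 n m) \<le> h 1}"
proof -
  have "(\<exists>k\<in>{1..h 1}. Poly_Mapping.lookup m k = 0) \<longleftrightarrow> hd (T0 n m) \<le> h 1"
    if "m \<in> staircase n" for m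
  proof
    assume "\<exists>k\<in>{1..h 1}. Poly_Mapping.lookup m k = 0"
    then show "hd (T0 n m) \<le> h 1"
      using lookup_hd_T0(4)[OF that assms] by (metis atLeastAtMost_iff linorder_not_less order_trans)
  next
    assume "hd (T0 n m) \<le> h 1"
    then show "\<exists>k\<in>{1..h 1}. Poly_Mapping.lookup m k = 0"
      using lookup_hd_T0(1,3)[OF that assms] by auto
  qed
  then show ?thesis
    by (auto simp: B1_eq)
qed

text \<open>Membership in \<open>B1\<close> ensures that the \<open>LEAST\<close> ranges over a
  nonempty set. This is the claim that k' occupies the bottom box; it also holds when the first
  exponent is 0, with k' = 1.\<close>

lemma k_prime_eq:
  assumes "m \<in> B1 n h" "1 \<le> n"
  shows "k_prime h m = hd (T0 n m)"
  unfolding k_prime_def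
proof (rule Least_equality)
  have m: "m \<in> staircase n" "hd (T0 n m) \<le> h 1"
    using assms by (auto simp: B1_eq_hd_T0)
  show "hd (T0 n m) \<in> {1..h 1} \<and> Poly_Mapping.lookup m (hd (T0 n m)) = 0"
    using lookup_hd_T0[OF m(1) assms(2)] m(2) by auto
  show "hd (T0 n m) \<le> k" if "k \<in> {1..h 1} \<and> Poly_Mapping.lookup m k = 0" for k
    using lookup_hd_T0(4)[OF m(1) assms(2), of k] that by (meson atLeastAtMost_iff linorder_not_less)
qed

lemma lookup_1_eq_0_iff:
  assumes "m \<in> staircase n" "1 \<le> n"
  shows "Poly_Mapping.lookup m 1 = 0 \<longleftrightarrow> hd (T0 n m) = 1"
proof
  assume "Poly_Mapping.lookup m 1 = 0"
  then have "\<not> 1 < hd (T0 n m)"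
    using lookup_hd_T0(4)[OF assms, of 1] by blast
  then show "hd (T0 n m) = 1"
    using lookup_hd_T0(1)[OF assms] by simp
qed (use lookup_hd_T0(3)[OF assms] in simp)

section \<open>Moving the bottom entry directly below 1\<close>

definition raise_bottom :: "nat list \<Rightarrow> nat list" where
  "raise_bottom xs = (if hd xs = 1 then xs else insert_below (hd xs) 1 (tl xs))"

text \<open>The intended inverse of \<open>raise_bottom\<close>: the entry directly below 1 is the
  last one before 1 in the list.\<close>

definition lower_to_bottom :: "nat list \<Rightarrow> nat list" where
  "lower_to_bottom ys = (if hd ys = 1 then ys else
     last (takeWhile (\<lambda>x. x \<noteq> 1) ys) # butlast (takeWhile (\<lambda>x. x \<noteq> 1) ys) @ dropWhile (\<lambda>x. x \<noteq> 1) ys)"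

text \<open>Quantifying over positions makes this vacuous when 1 is at the bottom and matches the
  column condition of \<open>P_tableaux\<close>.\<close>

definition below_one_at_most :: "nat \<Rightarrow> nat list \<Rightarrow> bool" where
  "below_one_at_most p ys \<longleftrightarrow> (\<forall>r. Suc r < length ys \<longrightarrow> ys ! Suc r = 1 \<longrightarrow> ys ! r \<le> p)"

text \<open>Both the case distinction on the first exponent and the entry k' can be read off the
  bottom of \<open>T0\<close>, so the second stage depends on the column alone.\<close>

lemma phi_column_eq:
  assumes "m \<in> B1 n h" "1 \<le> n"
  shows "phi_column n h m = raise_bottom (T0 n m)"
  using assms lookup_1_eq_0_iff[of m n] k_prime_eq[OF assms]
  by (simp add: phi_column_def raise_bottom_def B1_eq)

lemma raise_bottom_Cons:
  assumes "b \<noteq> 1" "1 \<notin> set us"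
  shows "raise_bottom (b # us @ 1 # vs) = us @ b # 1 # vs"
proof -
  have "takeWhile (\<lambda>x. x \<noteq> 1) (us @ 1 # vs) = us" "dropWhile (\<lambda>x. x \<noteq> 1) (us @ 1 # vs) = 1 # vs"
    using assms by (auto simp: takeWhile_append dropWhile_append)
  then show ?thesis
    using assms by (simp add: raise_bottom_def insert_below_def)
qed

lemma lower_to_bottom_append:
  assumes "b \<noteq> 1" "1 \<notin> set us"
  shows "lower_to_bottom (us @ b # 1 # vs) = b # us @ 1 # vs"
proof -
  have "takeWhile (\<lambda>x. x \<noteq> 1) ((us @ [b]) @ 1 # vs) = us @ [b]"
    "dropWhile (\<lambda>x. x \<noteq> 1) ((us @ [b]) @ 1 # vs) = 1 # vs"
    using assms by (subst takeWhile_append2 dropWhile_append2; auto)+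
  moreover have "hd (us @ b # 1 # vs) \<noteq> 1"
    using assms by (cases us) auto
  ultimately show ?thesis
    by (simp add: lower_to_bottom_def)
qed

text \<open>The segment below 1 is empty or splits at its first entry, as raising needs;
  \<open>columns_below_cases\<close> splits it at its last entry, as lowering needs.\<close>

lemma columns_bottom_cases:
  assumes "xs \<in> columns n" "1 \<le> n"
  obtains "hd xs = 1" | b us vs where "xs = b # us @ 1 # vs" "b \<noteq> 1" "1 \<notin> set us"
proof -
  have "distinct xs" "1 \<in> set xs"
    using assms by (auto simp: columns_def)
  then obtain us vs where "xs = us @ 1 # vs" "1 \<notin> set us"
    by (meson split_list_first)
  then show thesis
    using that by (cases us) auto
qed

lemma columns_below_cases:
  assumes "ys \<in> columns n" "1 \<le> n"
  obtains "hd ys = 1" | b us vs where "ys = us @ b # 1 # vs" "b \<noteq> 1" "1 \<notin> set us"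
proof -
  have "distinct ys" "1 \<in> set ys"
    using assms by (auto simp: columns_def)
  then obtain us vs where "ys = us @ 1 # vs" "1 \<notin> set us"
    by (meson split_list_first)
  then show thesis
    using that by (cases us rule: rev_cases) auto
qed

lemma below_one_at_most_hd:
  assumes "distinct ys" "hd ys = 1"
  shows "below_one_at_most p ys"
  unfolding below_one_at_most_def
proof (intro allI impI)
  fix r assume r: "Suc r < length ys" "ys ! Suc r = 1"
  then have "ys ! 0 = ys ! Suc r"
    using assms by (metis hd_conv_nth list.size(3) not_less0)
  then show "ys ! r \<le> p"
    using r assms(1) by (metis length_greater_0_conv list.size(3) nat.distinct(1) not_less0 nth_eq_iff_index_eq)
qed

lemma below_one_at_most_append:
  assumes "distinct (us @ b # 1 # vs)"
  shows "below_one_at_most p (us @ b # 1 # vs) \<longleftrightarrow> b \<le> p"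
proof -
  let ?ys = "us @ b # 1 # vs"
  have one: "Suc (length us) < length ?ys" "?ys ! Suc (length us) = 1" "?ys ! length us = b"
    by (auto simp: nth_append)
  \<comment> \<open>By distinctness 1 occurs only once, so the condition concerns the single entry
    \<open>b\<close>.\<close>
  have "r = length us" if "Suc r < length ?ys" "?ys ! Suc r = 1" for r
    using that one nth_eq_iff_index_eq[OF assms, of "Suc r" "Suc (length us)"] by simp
  then show ?thesis
    unfolding below_one_at_most_def using one by metis
qed

text \<open>The two maps exchange \<open>b # us @ 1 # vs\<close> and \<open>us @ b # 1 # vs\<close>,
  and both side conditions then say \<open>b \<le> p\<close>. Columns with 1 at the bottom stay
  fixed; \<open>1 \<le> p\<close> puts them in the source.\<close>

lemma bij_betw_raise_bottom:
  assumes "1 \<le> n" "1 \<le> p"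
  shows "bij_betw raise_bottom {xs \<in> columns n. hd xs \<le> p} {ys \<in> columns n. below_one_at_most p ys}"
proof (rule bij_betw_byWitness[where f' = lower_to_bottom])
  show "\<forall>xs\<in>{xs \<in> columns n. hd xs \<le> p}. lower_to_bottom (raise_bottom xs) = xs"
  proof safe
    fix xs assume "xs \<in> columns n"
    from this assms(1) show "lower_to_bottom (raise_bottom xs) = xs"
    proof (cases rule: columns_bottom_cases)
      case (2 b us vs) then show ?thesis
        by (simp add: raise_bottom_Cons lower_to_bottom_append del: One_nat_def)
    qed (simp_all add: raise_bottom_def lower_to_bottom_def)
  qed
  show "\<forall>ys\<in>{ys \<in> columns n. below_one_at_most p ys}. raise_bottom (lower_to_bottom ys) = ys"
  proof safe
    fix ys assume "ys \<in> columns n"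
    from this assms(1) show "raise_bottom (lower_to_bottom ys) = ys"
    proof (cases rule: columns_below_cases)
      case (2 b us vs) then show ?thesis
        by (simp add: raise_bottom_Cons lower_to_bottom_append del: One_nat_def)
    qed (simp_all add: raise_bottom_def lower_to_bottom_def)
  qed
  show "raise_bottom ` {xs \<in> columns n. hd xs \<le> p} \<subseteq> {ys \<in> columns n. below_one_at_most p ys}"
  proof (rule image_subsetI, clarify)
    fix xs assume xs: "xs \<in> columns n" "hd xs \<le> p"
    from xs(1) assms(1) show "raise_bottom xs \<in> columns n \<and> below_one_at_most p (raise_bottom xs)"
    proof (cases rule: columns_bottom_cases)
      case 1 then show ?thesis
        using xs below_one_at_most_hd by (auto simp: raise_bottom_def columns_def)
    next
      case (2 b us vs)
      have eq: "raise_bottom xs = us @ b # 1 # vs"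
        using 2 by (simp add: raise_bottom_Cons del: One_nat_def)
      have col: "us @ b # 1 # vs \<in> columns n"
        using xs(1) 2 by (auto simp: columns_def)
      then have "below_one_at_most p (us @ b # 1 # vs)"
        using xs(2) 2 by (subst below_one_at_most_append) (auto simp: columns_def)
      with eq col show ?thesis by simp
    qed
  qed
  show "lower_to_bottom ` {ys \<in> columns n. below_one_at_most p ys} \<subseteq> {xs \<in> columns n. hd xs \<le> p}"
  proof (rule image_subsetI, clarify)
    fix ys assume ys: "ys \<in> columns n" "below_one_at_most p ys"
    from ys(1) assms(1) show "lower_to_bottom ys \<in> columns n \<and> hd (lower_to_bottom ys) \<le> p"
    proof (cases rule: columns_below_cases)
      case 1 then show ?thesis
        using ys assms(2) by (auto simp: lower_to_bottom_def)
    next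
      case (2 b us vs)
      have eq: "lower_to_bottom ys = b # us @ 1 # vs"
        using 2 by (simp add: lower_to_bottom_append del: One_nat_def)
      have "b # us @ 1 # vs \<in> columns n"
        using ys(1) 2 by (auto simp: columns_def)
      moreover have "b \<le> p"
        using ys 2 below_one_at_most_append by (auto simp: columns_def)
      ultimately show ?thesis using eq by simp
    qed
  qed
qed

section \<open>Tableaux of a single column\<close>

lemma map_length_eq_replicate_1:
  assumes "map length T = replicate n 1"
  shows "T = map (\<lambda>x. [x]) (concat T)"
  using assms
proof (induction T arbitrary: n)
  case (Cons t T)
  then obtain k where "n = Suc k"
    by (cases n) auto
  with Cons show ?case
    by (auto simp: length_Suc_conv)
qed simp

text \<open>Rows of length one satisfy the row condition vacuously. As \<open>h i = n\<close> for
  \<open>i\<close> from 2 on, only 1 has elements above it in the poset, so the column condition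
  restricts only the entry directly below 1.\<close>

lemma P_tableaux_column:
  assumes "\<forall>i\<in>{2..n}. h i = n"
  shows "P_tableaux n (hess_less n h) (replicate n 1)
    = map (\<lambda>x. [x]) ` {ys \<in> columns n. below_one_at_most (h 1) ys}" (is "?L = ?R")
proof -
  have part: "is_partition_of (replicate n 1) n"
    by (auto simp: is_partition_of_def sorted_wrt_iff_nth_less sum_list_replicate)
  have key: "map (\<lambda>x. [x]) ys \<in> ?L \<longleftrightarrow> below_one_at_most (h 1) ys" if ys: "ys \<in> columns n" for ys
  proof -
    have len: "length ys = n"
      using ys distinct_card[of ys] by (auto simp: columns_def)
    have less: "hess_less n h i j \<longleftrightarrow> i = 1 \<and> h 1 < j" if "i \<in> {1..n}" "j \<in> {1..n}" for i j
    proof (cases "i = 1")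
      case False
      with that have "h i = n" using assms by auto
      with that False show ?thesis by (auto simp: hess_less_def)
    qed (use that in \<open>auto simp: hess_less_def\<close>)
    have mem: "ys ! r \<in> {1..n}" if "r < n" for r
      using nth_mem[of r ys] ys len that by (auto simp: columns_def)
    have "map (\<lambda>x. [x]) ys \<in> ?L \<longleftrightarrow> (\<forall>r. Suc r < n \<longrightarrow> \<not> hess_less n h (ys ! Suc r) (ys ! r))"
    proof -
      let ?T = "map (\<lambda>x. [x]) ys"
      have rows: "r < length ?T \<and> Suc c < length (?T ! r) \<longrightarrow> lt (?T ! r ! c) (?T ! r ! Suc c)"
        for r c and lt :: "nat \<Rightarrow> nat \<Rightarrow> bool"
        by auto
      have cols: "(\<forall>r c. Suc r < length ?T \<and> c < length (?T ! Suc r) \<longrightarrow> \<not> lt (?T ! Suc r ! c) (?T ! r ! c))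
        \<longleftrightarrow> (\<forall>r. Suc r < n \<longrightarrow> \<not> lt (ys ! Suc r) (ys ! r))" (is "?A \<longleftrightarrow> ?B")
        for lt :: "nat \<Rightarrow> nat \<Rightarrow> bool"
      proof
        assume A: ?A
        show ?B
        proof (intro allI impI)
          fix r assume "Suc r < n"
          then show "\<not> lt (ys ! Suc r) (ys ! r)"
            using A[rule_format, of r 0] len by simp
        qed
      qed (use len in auto)
      have "map length ?T = replicate n 1" "concat ?T = ys"
        using len by (simp_all add: comp_def map_replicate_const)
      moreover have "distinct ys" "set ys = {1..n}"
        using ys by (auto simp: columns_def)
      ultimately show ?thesis
        unfolding P_tableaux_def mem_Collect_eq cols using part rows by metis
    qed
    also have "\<dots> \<longleftrightarrow> below_one_at_most (h 1) ys"
      unfolding below_one_at_most_def len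
      using less mem by (auto simp: not_less)
    finally show ?thesis .
  qed
  show ?thesis
  proof (rule set_eqI, rule iffI)
    fix T assume T: "T \<in> ?L"
    then have "T = map (\<lambda>x. [x]) (concat T)" "concat T \<in> columns n"
      using map_length_eq_replicate_1[of T n] by (auto simp: P_tableaux_def columns_def)
    with T key[of "concat T"] show "T \<in> ?R"
      by (intro image_eqI[of _ _ "concat T"]) auto
  next
    fix T assume "T \<in> ?R"
    then obtain ys where "ys \<in> columns n" "below_one_at_most (h 1) ys" "T = map (\<lambda>x. [x]) ys"
      by blast
    then show "T \<in> ?L"
      by (simp only: key)
  qed
qed

theorem theoremB:
  fixes n :: nat and h :: "nat \<Rightarrow> nat"
  assumes "2 \<le> n" and "1 \<le> h 1" and "h 1 \<le> n" and "\<forall>i\<in>{2..n}. h i = n"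
  shows "(\<forall>m\<in>B1 n h.
            (\<forall>k\<in>{1..<n}. \<exists>!ys.
                is_insertion k (Poly_Mapping.lookup m k) (partial_column n m (Suc k)) ys)
          \<and> (Poly_Mapping.lookup m 1 \<noteq> 0 \<longrightarrow>
                (\<exists>k\<in>{1..h 1}. Poly_Mapping.lookup m k = 0) \<and> hd (T0 n m) = k_prime h m)
          \<and> phi n h m \<in> P_tableaux n (hess_less n h) (replicate n 1))
       \<and> bij_betw (phi n h) (B1 n h) (P_tableaux n (hess_less n h) (replicate n 1))"
proof -
  let ?X = "{xs \<in> columns n. hd xs \<le> h 1}" and ?Y = "{ys \<in> columns n. below_one_at_most (h 1) ys}"
  have n: "1 \<le> n" using assms(1) by simp
  have T0: "bij_betw (T0 n) (B1 n h) ?X"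
    using bij_betw_T0[OF n] unfolding B1_eq_hd_T0[OF n] bij_betw_def
    by (auto intro: inj_on_subset)
  have single: "bij_betw (map (\<lambda>x. [x])) ?Y (P_tableaux n (hess_less n h) (replicate n 1))"
    unfolding P_tableaux_column[OF assms(4)]
    by (intro inj_on_imp_bij_betw inj_onI) (auto simp: inj_def)
  \<comment> \<open>Three bijections are composed: decoding the exponents, raising the bottom entry,
    and making each entry a row.\<close>
  have "bij_betw (map (\<lambda>x. [x]) \<circ> (raise_bottom \<circ> T0 n)) (B1 n h)
      (P_tableaux n (hess_less n h) (replicate n 1))"
    using T0 bij_betw_raise_bottom[OF n assms(2)] single by (blast intro: bij_betw_trans)
  \<comment> \<open>\<open>phi_column_eq\<close> identifies \<open>phi\<close> with the composite
    only on \<open>B1\<close>, hence the congruence rule.\<close>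
  then have bij: "bij_betw (phi n h) (B1 n h) (P_tableaux n (hess_less n h) (replicate n 1))"
    by (rule bij_betw_cong[THEN iffD1, rotated]) (simp add: phi_def phi_column_eq[OF _ n])
  \<comment> \<open>Well-definedness: a unique position at each insertion, then existence of k' and
    its place at the bottom.\<close>
  have "\<exists>!ys. is_insertion k (Poly_Mapping.lookup m k) (partial_column n m (Suc k)) ys"
    if "m \<in> B1 n h" "k \<in> {1..<n}" for m k
    using partial_column_Suc(1)[of m n k] that by (simp add: B1_eq is_insertion_iff)
  moreover have "\<exists>k\<in>{1..h 1}. Poly_Mapping.lookup m k = 0" if "m \<in> B1 n h" for m
    using that by (simp add: B1_eq)
  moreover have "hd (T0 n m) = k_prime h m" if "m \<in> B1 n h" for m
    using k_prime_eq[OF that n] by simp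
  moreover have "phi n h m \<in> P_tableaux n (hess_less n h) (replicate n 1)" if "m \<in> B1 n h" for m
    using bij_betwE[OF bij] that by blast
  ultimately show ?thesis
    using bij by (intro conjI ballI impI)
qed

end
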